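(* Let $G$ be a finite connected graph of order $n$, maximum degree $\Delta$, with $\ell$ leaves, such that $C(G)\neq\emptyset$. Let $V_{o}$ be the set of vertices of odd degree. Then (i) $$\gamma_{s}(G)\geq \frac{\left(\lceil\frac{\delta^{*}}{2}\rceil-\lfloor\frac{\Delta}{2}\rfloor+1\right)n+2\lfloor\frac{\Delta}{2}\rfloor \ell}{\lceil\frac{\delta^{*}}{2}\rceil+\lfloor\frac{\Delta}{2}\rfloor+1};$$ (ii) $$\gamma_{s}(G)\geq \frac{\left(\lceil\frac{3\delta^{*}}{2}\rceil-\lfloor\frac{3\Delta}{2}\rfloor+3\right)n+2\left(\lfloor\frac{\Delta}{2}\rfloor \ell+|V_o|\right)}{\lceil\frac{3\delta^{*}}{2}\rceil+\lfloor\frac{3\Delta}{2}\rfloor+3}.$$ Moreover, both bounds are sharp: for every $n\geq 3$ equality holds in (i) and in (ii) for the complete graph $K_n$.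
   Context: A signed dominating function (SDF) of $G$ is a function $f:V(G)\to\{-1,1\}$ with $f(N[v])=\sum_{u\in N[v]}f(u)\geq 1$ for every vertex $v$, where $N[v]$ is the closed neighborhood; $\gamma_s(G)$ is the minimum of $\sum_{v} f(v)$ over all SDFs. Let $O$ be the set of isolated vertices, $L$ the set of leaves (degree-$1$ vertices), $S$ the set of support vertices (vertices adjacent to a leaf), $C(G)=V(G)\setminus(O\cup L\cup S)$, and $\delta^{*}=\min\{\deg(v): v\in C(G)\}$. *)

theory Defs
  imports Complex_Main "HOL-Library.FuncSet" "Graph_Theory.Graph_Theory"
begin

text \<open>
  Finite simple undirected graphs are the locale \<^locale>\<open>graph\<close>: finite, loop-free,
  symmetric digraphs without parallel arcs.  An undirected edge is a pair of opposite arcs, so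
  degrees are counted by neighbours rather than by incident arcs.
\<close>

definition open_nbhd :: "('a, 'b) pre_digraph \<Rightarrow> 'a \<Rightarrow> 'a set" where
  "open_nbhd G v = {u \<in> verts G. (v, u) \<in> arcs_ends G}"

definition closed_nbhd :: "('a, 'b) pre_digraph \<Rightarrow> 'a \<Rightarrow> 'a set" where
  "closed_nbhd G v = insert v (open_nbhd G v)"

definition deg :: "('a, 'b) pre_digraph \<Rightarrow> 'a \<Rightarrow> nat" where
  "deg G v = card (open_nbhd G v)"

definition max_deg :: "('a, 'b) pre_digraph \<Rightarrow> nat" where
  "max_deg G = Max (deg G ` verts G)"

definition isolated_verts :: "('a, 'b) pre_digraph \<Rightarrow> 'a set" where
  "isolated_verts G = {v \<in> verts G. deg G v = 0}"

definition leaves :: "('a, 'b) pre_digraph \<Rightarrow> 'a set" where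
  "leaves G = {v \<in> verts G. deg G v = 1}"

definition support_verts :: "('a, 'b) pre_digraph \<Rightarrow> 'a set" where
  "support_verts G = {v \<in> verts G. open_nbhd G v \<inter> leaves G \<noteq> {}}"

definition core_verts :: "('a, 'b) pre_digraph \<Rightarrow> 'a set" where
  "core_verts G = verts G - (isolated_verts G \<union> leaves G \<union> support_verts G)"

text \<open>\<open>\<delta>\<^sup>*\<close>; only meaningful if \<open>core_verts G \<noteq> {}\<close>.\<close>

definition min_core_deg :: "('a, 'b) pre_digraph \<Rightarrow> nat" where
  "min_core_deg G = Min (deg G ` core_verts G)"

definition odd_verts :: "('a, 'b) pre_digraph \<Rightarrow> 'a set" where
  "odd_verts G = {v \<in> verts G. odd (deg G v)}"

definition signed_dominating :: "('a, 'b) pre_digraph \<Rightarrow> ('a \<Rightarrow> int) \<Rightarrow> bool" where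
  "signed_dominating G f \<longleftrightarrow>
     f \<in> verts G \<rightarrow> {-1, 1} \<and> (\<forall>v \<in> verts G. (\<Sum>u \<in> closed_nbhd G v. f u) \<ge> 1)"

text \<open>
  The set of weights is finite, since they lie between \<open>- card (verts G)\<close> and \<open>card (verts G)\<close>,
  and nonempty, since the constant function 1 is signed dominating.
\<close>

definition signed_dom_number :: "('a, 'b) pre_digraph \<Rightarrow> int" where
  "signed_dom_number G = Min {(\<Sum>v \<in> verts G. f v) | f. signed_dominating G f}"

definition sd_bound1 :: "('a, 'b) pre_digraph \<Rightarrow> real" where
  "sd_bound1 G =
     (let n = real (card (verts G)); l = real (card (leaves G));
          d = real (min_core_deg G); D = real (max_deg G)
      in ((of_int \<lceil>d / 2\<rceil> - of_int \<lfloor>D / 2\<rfloor> + 1) * n + 2 * of_int \<lfloor>D / 2\<rfloor> * l)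
         / (of_int \<lceil>d / 2\<rceil> + of_int \<lfloor>D / 2\<rfloor> + 1))"

definition sd_bound2 :: "('a, 'b) pre_digraph \<Rightarrow> real" where
  "sd_bound2 G =
     (let n = real (card (verts G)); l = real (card (leaves G));
          d = real (min_core_deg G); D = real (max_deg G)
      in ((of_int \<lceil>3 * d / 2\<rceil> - of_int \<lfloor>3 * D / 2\<rfloor> + 3) * n
            + 2 * (of_int \<lfloor>D / 2\<rfloor> * l + real (card (odd_verts G))))
         / (of_int \<lceil>3 * d / 2\<rceil> + of_int \<lfloor>3 * D / 2\<rfloor> + 3))"

text \<open>
  \<^const>\<open>complete_digraph\<close> is a predicate on graphs; it is inhabited for every order over the
  vertex type \<^typ>\<open>nat\<close>.
\<close>

lemma complete_digraph_nat:
  "complete_digraph n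
     (with_proj \<lparr>pverts = {..<n}, parcs = {(u, v). u < n \<and> v < n \<and> u \<noteq> v}\<rparr>)"
  by (subst complete_digraph_pair_def) auto

end

theory Submission
  imports Defs
begin

text \<open>
  Let \<open>M\<close> and \<open>P\<close> be the sets of vertices on which a signed dominating function takes the values
  \<open>-1\<close> and \<open>1\<close>.  Leaves and support vertices lie in \<open>P\<close>, so every vertex of \<open>M\<close> has degree at least
  \<open>\<delta>\<^sup>*\<close>.  A vertex of \<open>M\<close> of degree \<open>d\<close> has at least \<open>\<lceil>d/2\<rceil> + 1\<close> neighbours in \<open>P\<close>, a vertex of \<open>P\<close>
  has at most \<open>\<lfloor>d/2\<rfloor>\<close> neighbours in \<open>M\<close>, and a leaf has none.  Counting the edges between \<open>M\<close> and
  \<open>P\<close> from both sides bounds \<open>|M|\<close>, hence the weight \<open>n - 2|M|\<close> from below.  The second bound counts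
  every such edge three times, using the rounding in \<open>d/2\<close> at odd vertices for two of the copies.
\<close>

section \<open>Rounded halves as natural-number division\<close>

lemma floor_half_real: "\<lfloor>real m / 2\<rfloor> = int (m div 2)"
  using floor_divide_of_nat_eq[where ?'a = real, of m 2] by simp

lemma ceiling_half_real: "\<lceil>real m / 2\<rceil> = int ((m + 1) div 2)"
proof -
  have "m = 2 * (m div 2) \<or> m = 2 * (m div 2) + 1" by presburger
  then show ?thesis by (elim disjE) (rule ceiling_unique; linarith)+
qed

text \<open>Splitting off the integer \<open>m\<close> leaves only a half to round. In this form the
  three counted copies of an edge separate: two share the unrounded \<open>m\<close>, one gets the
  rounded half.\<close>

lemma floor_three_halves_real: "\<lfloor>3 * real m / 2\<rfloor> = int (m + m div 2)"
proof -
  have "3 * real m / 2 = real m / 2 + of_int (int m)" by simp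
  then show ?thesis by (simp only: floor_add_int[symmetric] floor_half_real of_nat_add add.commute[of "int m"])
qed

lemma ceiling_three_halves_real: "\<lceil>3 * real m / 2\<rceil> = int (m + (m + 1) div 2)"
proof -
  have "3 * real m / 2 = real m / 2 + of_int (int m)" by simp
  then show ?thesis by (simp only: ceiling_add_of_int ceiling_half_real of_nat_add add.commute[of "int m"])
qed

section \<open>Signs in neighbourhoods and the number of negative vertices\<close>

context graph
begin

lemma finite_open_nbhd [simp]: "finite (open_nbhd G v)"
  unfolding open_nbhd_def by simp

lemma open_nbhd_irrefl: "v \<notin> open_nbhd G v"
  unfolding open_nbhd_def using adj_not_same by blast

lemma mem_open_nbhd_sym:
  assumes "v \<in> verts G"
  shows "u \<in> verts G \<and> v \<in> open_nbhd G u \<longleftrightarrow> u \<in> open_nbhd G v"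
  using assms graph_symmetric unfolding open_nbhd_def by auto

lemma deg_le_max_deg: "v \<in> verts G \<Longrightarrow> deg G v \<le> max_deg G"
  unfolding max_deg_def by simp

lemma min_core_deg_le: "v \<in> core_verts G \<Longrightarrow> min_core_deg G \<le> deg G v"
  unfolding min_core_deg_def core_verts_def by simp

text \<open>Exchanging the sums over adjacent pairs leaves each pair seen from its other end, and
  adjacency is symmetric.\<close>

lemma double_count_edges:
  assumes "A \<subseteq> verts G" "B \<subseteq> verts G"
  shows "(\<Sum>v\<in>A. int (card (open_nbhd G v \<inter> B))) = (\<Sum>v\<in>B. int (card (open_nbhd G v \<inter> A)))"
proof -
  have fin: "finite A" "finite B" using assms finite_verts finite_subset by blast+
  have "(\<Sum>v\<in>A. int (card (open_nbhd G v \<inter> B)))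
      = (\<Sum>v\<in>A. \<Sum>u | u \<in> B \<and> u \<in> open_nbhd G v. (1::int))"
    by (intro sum.cong) (auto intro!: arg_cong[of _ _ card])
  also have "\<dots> = (\<Sum>u\<in>B. \<Sum>v | v \<in> A \<and> u \<in> open_nbhd G v. (1::int))"
    using fin by (rule sum.swap_restrict)
  also have "\<dots> = (\<Sum>v\<in>B. int (card (open_nbhd G v \<inter> A)))"
    using assms mem_open_nbhd_sym by (intro sum.cong) (auto intro!: arg_cong[of _ _ card])
  finally show ?thesis .
qed

text \<open>Each neighbour contributes its sign, so the sum over N[v] is \<open>f v\<close> plus a
  difference of two counts. The degree estimates below rest on this pair of facts.\<close>

lemma signed_dominating_counts:
  assumes f: "signed_dominating G f"
  defines "M \<equiv> {v \<in> verts G. f v = -1}" and "P \<equiv> {v \<in> verts G. f v = 1}"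
  assumes v: "v \<in> verts G"
  shows "deg G v = card (open_nbhd G v \<inter> P) + card (open_nbhd G v \<inter> M)"
    and "f v + int (card (open_nbhd G v \<inter> P)) - int (card (open_nbhd G v \<inter> M)) \<ge> 1"
proof -
  have range: "f u = -1 \<or> f u = 1" if "u \<in> verts G" for u
    using f that unfolding signed_dominating_def by auto
  have split: "open_nbhd G v = (open_nbhd G v \<inter> P) \<union> (open_nbhd G v \<inter> M)"
    using range unfolding M_def P_def open_nbhd_def by auto
  have disj: "(open_nbhd G v \<inter> P) \<inter> (open_nbhd G v \<inter> M) = {}"
    unfolding M_def P_def by auto
  show "deg G v = card (open_nbhd G v \<inter> P) + card (open_nbhd G v \<inter> M)"
    unfolding deg_def by (subst split, subst card_Un_disjoint) (use disj in auto)
  have "(\<Sum>u\<in>open_nbhd G v. f u) = (\<Sum>u\<in>open_nbhd G v \<inter> P. f u) + (\<Sum>u\<in>open_nbhd G v \<inter> M. f u)"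
    by (subst split, subst sum.union_disjoint) (use disj in auto)
  also have "(\<Sum>u\<in>open_nbhd G v \<inter> P. f u) = int (card (open_nbhd G v \<inter> P))"
    unfolding P_def by simp
  also have "(\<Sum>u\<in>open_nbhd G v \<inter> M. f u) = - int (card (open_nbhd G v \<inter> M))"
    unfolding M_def by simp
  finally have "(\<Sum>u\<in>closed_nbhd G v. f u)
      = f v + int (card (open_nbhd G v \<inter> P)) - int (card (open_nbhd G v \<inter> M))"
    unfolding closed_nbhd_def using open_nbhd_irrefl by simp
  then show "f v + int (card (open_nbhd G v \<inter> P)) - int (card (open_nbhd G v \<inter> M)) \<ge> 1"
    using f v unfolding signed_dominating_def by force
qed

lemma negative_vertex_in_core:
  assumes f: "signed_dominating G f" and v: "v \<in> verts G" "f v = -1"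
  shows "v \<in> core_verts G"
proof -
  note c = signed_dominating_counts[OF f]
  have "v \<notin> isolated_verts G \<union> leaves G"
    using c[OF v(1)] v unfolding isolated_verts_def leaves_def by auto
  moreover have "v \<notin> support_verts G"
  proof
    assume "v \<in> support_verts G"
    then obtain u where u: "u \<in> open_nbhd G v" "u \<in> leaves G"
      unfolding support_verts_def by auto
    then have uV: "u \<in> verts G" "deg G u = 1" unfolding leaves_def by auto
    \<comment> \<open>The only neighbour of the leaf \<open>u\<close> is the negative
      \<open>v\<close>, so the sum over N[u] is at most 1 - 1 = 0.\<close>
    have "v \<in> open_nbhd G u \<inter> {v \<in> verts G. f v = -1}"
      using u v mem_open_nbhd_sym[OF v(1)] by auto
    then have "card (open_nbhd G u \<inter> {v \<in> verts G. f v = -1}) \<noteq> 0"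
      by (subst card_0_eq) auto
    moreover have "f u \<le> 1" using f uV(1) unfolding signed_dominating_def by force
    ultimately show False using c[OF uV(1)] uV(2) by linarith
  qed
  ultimately show ?thesis using v unfolding core_verts_def by auto
qed

lemma signed_dominating_weight:
  assumes f: "signed_dominating G f"
  shows "(\<Sum>v\<in>verts G. f v) = int (card (verts G)) - 2 * int (card {v \<in> verts G. f v = -1})"
proof -
  have "(\<Sum>v\<in>verts G. f v) = (\<Sum>v\<in>verts G. 1 - 2 * of_bool (f v = -1))"
    using f unfolding signed_dominating_def by (intro sum.cong) auto
  also have "\<dots> = int (card (verts G)) - 2 * int (card {v \<in> verts G. f v = -1})"
    by (simp add: sum_subtractf sum_distrib_left[symmetric] Int_def)
  finally show ?thesis .
qed

text \<open>Kept over the integers and free of division: \<open>c\<close> and \<open>F\<close> are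
  the rounded halves of \<delta>* and \<Delta>, so \<open>min_core_deg G + c\<close> and
  \<open>max_deg G + F\<close> are the rounded three halves.\<close>

lemma negative_count_bounds:
  assumes f: "signed_dominating G f"
  defines "m \<equiv> int (card {v \<in> verts G. f v = -1})"
    and "n \<equiv> int (card (verts G))" and "l \<equiv> int (card (leaves G))"
    and "c \<equiv> (min_core_deg G + 1) div 2" and "F \<equiv> max_deg G div 2"
  shows "m * (int c + 1) \<le> int F * (n - m) - int F * l"
    and "m * (int (min_core_deg G + c) + 3)
           \<le> int (max_deg G + F) * (n - m) - int F * l - int (card (odd_verts G))"
proof -
  define M where "M = {v \<in> verts G. f v = -1}"
  define P where "P = {v \<in> verts G. f v = 1}"
  define a where "a v = int (card (open_nbhd G v \<inter> M))" for v
  define b where "b v = int (card (open_nbhd G v \<inter> P))" for v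
  have VMP: "verts G = M \<union> P" "M \<inter> P = {}"
    using f unfolding M_def P_def signed_dominating_def by auto
  then have sub: "M \<subseteq> verts G" "P \<subseteq> verts G" by auto
  then have fin: "finite M" "finite P" using finite_verts finite_subset by blast+
  have m: "m = int (card M)" unfolding m_def M_def ..
  have p: "n - m = int (card P)"
    unfolding n_def m using card_Un_disjoint[OF fin VMP(2)] VMP(1) by simp
  have edges: "(\<Sum>v\<in>M. b v) = (\<Sum>v\<in>P. a v)"
    unfolding a_def b_def using sub by (rule double_count_edges)
  have counts: "int (deg G v) = b v + a v" "f v + b v - a v \<ge> 1" if "v \<in> verts G" for v
    using signed_dominating_counts[OF f that] unfolding a_def b_def M_def P_def by auto
  have a0: "a v \<ge> 0" for v unfolding a_def by simp
  \<comment> \<open>With all leaves in \<open>P\<close>, the number \<open>l\<close> becomes a sum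
    over \<open>P\<close> and can be charged vertex by vertex.\<close>
  have "leaves G \<inter> M = {}"
    using negative_vertex_in_core[OF f] unfolding M_def core_verts_def by auto
  then have leaves: "leaves G = {v \<in> P. deg G v = 1}"
    using VMP unfolding leaves_def by auto
  have l: "l = (\<Sum>v\<in>P. of_bool (deg G v = 1))"
    unfolding l_def leaves using fin by (simp add: Int_def)
  have "odd_verts G = {v \<in> M. odd (deg G v)} \<union> {v \<in> P. odd (deg G v)}"
    unfolding odd_verts_def VMP(1) by auto
  then have "card (odd_verts G) = card {v \<in> M. odd (deg G v)} + card {v \<in> P. odd (deg G v)}"
    using fin VMP(2) by (simp, subst card_Un_disjoint) auto
  then have o: "int (card (odd_verts G))
      = (\<Sum>v\<in>M. of_bool (odd (deg G v))) + (\<Sum>v\<in>P. of_bool (odd (deg G v)))"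
    using fin by (simp add: Int_def)

  have M1: "int c + 1 \<le> b v"
    and M2: "int (min_core_deg G + c) + 3 + of_bool (odd (deg G v)) \<le> 3 * b v" if "v \<in> M" for v
  proof -
    have v: "v \<in> verts G" "f v = -1" using that unfolding M_def by auto
    have d: "min_core_deg G \<le> deg G v" using negative_vertex_in_core[OF f v] by (rule min_core_deg_le)
    \<comment> \<open>Here \<open>b v - a v\<close> is at least 2 and \<open>a v + b v\<close> is
      the degree; as \<open>2 * b v\<close> is even, an odd degree gains one more. The tripled
      estimate adds this to \<open>int c + 1 \<le> b v\<close>.\<close>
    have half: "2 * b v \<ge> int (deg G v) + 2 + of_bool (odd (deg G v))"
    proof (cases "odd (deg G v)")
      case True
      then show ?thesis using counts[OF v(1)] v(2) by simp presburger
    next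
      case False
      then show ?thesis using counts[OF v(1)] v(2) by simp
    qed
    have c: "2 * int c \<le> int (min_core_deg G) + 1" unfolding c_def by linarith
    show "int c + 1 \<le> b v"
      using half d c by (cases "odd (deg G v)") (auto; presburger)+
    then show "int (min_core_deg G + c) + 3 + of_bool (odd (deg G v)) \<le> 3 * b v"
      using half d by simp
  qed
  have P1: "a v + int F * of_bool (deg G v = 1) \<le> int F"
    and P2: "3 * a v + of_bool (odd (deg G v)) + int F * of_bool (deg G v = 1)
      \<le> int (max_deg G + F)" if "v \<in> P" for v
  proof -
    have v: "v \<in> verts G" "f v = 1" using that unfolding P_def by auto
    have d: "deg G v \<le> max_deg G" using v by (intro deg_le_max_deg)
    have le: "a v \<le> b v" using counts[OF v(1)] v(2) by simp
    \<comment> \<open>Parity again: \<open>2 * a v\<close> is even and at most the degree.\<close>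
    have half: "2 * a v + of_bool (odd (deg G v)) \<le> int (deg G v)"
    proof (cases "odd (deg G v)")
      case True
      then show ?thesis using counts(1)[OF v(1)] le by simp presburger
    next
      case False
      then show ?thesis using counts(1)[OF v(1)] le by simp
    qed
    have aF: "a v \<le> int F" using half d unfolding F_def by (cases "odd (deg G v)") (simp; linarith)+
    have leaf: "a v = 0" if "deg G v = 1" using half that a0[of v] by simp
    show "a v + int F * of_bool (deg G v = 1) \<le> int F"
      using aF leaf by (cases "deg G v = 1") auto
    show "3 * a v + of_bool (odd (deg G v)) + int F * of_bool (deg G v = 1) \<le> int (max_deg G + F)"
      using aF half d leaf by (cases "deg G v = 1") auto
  qed

  have "m * (int c + 1) \<le> (\<Sum>v\<in>M. b v)"
    unfolding m using sum_mono[OF M1] by simp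
  moreover have "(\<Sum>v\<in>P. a v) + int F * l \<le> int F * (n - m)"
    unfolding p l using sum_mono[OF P1] by (simp add: sum.distrib sum_distrib_left mult.commute)
  ultimately show "m * (int c + 1) \<le> int F * (n - m) - int F * l"
    using edges by linarith

  have "m * (int (min_core_deg G + c) + 3) + (\<Sum>v\<in>M. of_bool (odd (deg G v))) \<le> 3 * (\<Sum>v\<in>M. b v)"
    unfolding m using sum_mono[OF M2, of M "\<lambda>v. v"]
    by (simp add: sum.distrib sum_distrib_left distrib_left)
  moreover have "3 * (\<Sum>v\<in>P. a v) + (\<Sum>v\<in>P. of_bool (odd (deg G v))) + int F * l
      \<le> int (max_deg G + F) * (n - m)"
    unfolding p l using sum_mono[OF P2, of P "\<lambda>v. v"]
    by (simp only: sum.distrib sum_distrib_left sum_constant mult.commute[of _ "int (card P)"])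
  ultimately show "m * (int (min_core_deg G + c) + 3)
      \<le> int (max_deg G + F) * (n - m) - int F * l - int (card (odd_verts G))"
    using edges o by linarith
qed

section \<open>From negative vertices to weights and the signed domination number\<close>

lemma signed_dominating_weight_ge:
  assumes f: "signed_dominating G f"
  shows "sd_bound1 G \<le> real_of_int (\<Sum>v\<in>verts G. f v)"
    and "sd_bound2 G \<le> real_of_int (\<Sum>v\<in>verts G. f v)"
proof -
  note b = negative_count_bounds[OF f, THEN of_int_le_iff[where ?'a = real, THEN iffD2]]
  have w: "real_of_int (\<Sum>v\<in>verts G. f v)
      = real (card (verts G)) - 2 * real (card {v \<in> verts G. f v = -1})"
    by (subst signed_dominating_weight[OF f]) simp
  \<comment> \<open>With weight n - 2m, multiplying by the positive denominator turns each bound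
    into twice the corresponding inequality for m.\<close>
  show "sd_bound1 G \<le> real_of_int (\<Sum>v\<in>verts G. f v)"
    unfolding sd_bound1_def Let_def floor_half_real ceiling_half_real w
    using b(1) by (subst pos_divide_le_eq) (simp_all add: algebra_simps)
  show "sd_bound2 G \<le> real_of_int (\<Sum>v\<in>verts G. f v)"
    unfolding sd_bound2_def Let_def floor_half_real floor_three_halves_real
      ceiling_three_halves_real w
    using b(2) by (subst pos_divide_le_eq) (simp_all add: algebra_simps)
qed

lemma finite_weights: "finite {(\<Sum>v\<in>verts G. f v) | f. signed_dominating G f}"
proof (rule finite_subset)
  show "{(\<Sum>v\<in>verts G. f v) | f. signed_dominating G f}
      \<subseteq> {- int (card (verts G)) .. int (card (verts G))}"
  proof safe
    fix f assume "signed_dominating G f"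
    moreover have "card {v \<in> verts G. f v = -1} \<le> card (verts G)"
      by (intro card_mono) auto
    ultimately show "(\<Sum>v\<in>verts G. f v) \<in> {- int (card (verts G)) .. int (card (verts G))}"
      by (simp add: signed_dominating_weight)
  qed
qed simp

lemma signed_dominating_one: "signed_dominating G (\<lambda>_. 1)"
  unfolding signed_dominating_def closed_nbhd_def using open_nbhd_irrefl by simp

lemma signed_dom_number_attained:
  obtains f where "signed_dominating G f" "signed_dom_number G = (\<Sum>v\<in>verts G. f v)"
proof -
  have "signed_dom_number G \<in> {(\<Sum>v\<in>verts G. f v) | f. signed_dominating G f}"
    unfolding signed_dom_number_def
    using finite_weights signed_dominating_one by (intro Min_in) auto
  then show ?thesis using that by auto
qed

lemma signed_dom_number_le:
  "signed_dominating G f \<Longrightarrow> signed_dom_number G \<le> (\<Sum>v\<in>verts G. f v)"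
  unfolding signed_dom_number_def using finite_weights by (intro Min_le) auto

lemma signed_dom_number_ge_bounds:
  "sd_bound1 G \<le> real_of_int (signed_dom_number G)"
  "sd_bound2 G \<le> real_of_int (signed_dom_number G)"
  by (metis signed_dom_number_attained signed_dominating_weight_ge)+

end

section \<open>Sharpness for complete graphs\<close>

locale complete_graph = graph +
  fixes n :: nat
  assumes complete: "complete_digraph n G" and order_ge_3: "n \<ge> 3"
begin

lemma card_verts: "card (verts G) = n"
  using complete unfolding complete_digraph_def by blast

lemma verts_nonempty: "verts G \<noteq> {}"
  using card_verts order_ge_3 by auto

lemma open_nbhd_complete: "v \<in> verts G \<Longrightarrow> open_nbhd G v = verts G - {v}"
  using complete unfolding complete_digraph_def open_nbhd_def by auto

lemma closed_nbhd_complete: "v \<in> verts G \<Longrightarrow> closed_nbhd G v = verts G"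
  unfolding closed_nbhd_def using open_nbhd_complete by auto

lemma deg_complete: "v \<in> verts G \<Longrightarrow> deg G v = n - 1"
  unfolding deg_def by (simp add: open_nbhd_complete card_verts)

lemma leaves_complete: "leaves G = {}"
  unfolding leaves_def using deg_complete order_ge_3 by auto

lemma core_verts_complete: "core_verts G = verts G"
  unfolding core_verts_def isolated_verts_def support_verts_def
  using deg_complete leaves_complete order_ge_3 by auto

lemma max_deg_complete: "max_deg G = n - 1"
proof -
  have "deg G ` verts G = {n - 1}" using deg_complete verts_nonempty by auto
  then show ?thesis unfolding max_deg_def by simp
qed

lemma min_core_deg_complete: "min_core_deg G = n - 1"
proof -
  have "deg G ` verts G = {n - 1}" using deg_complete verts_nonempty by auto
  then show ?thesis unfolding min_core_deg_def core_verts_complete by simp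
qed

lemma card_odd_verts_complete: "card (odd_verts G) = (if even n then n else 0)"
proof -
  have "odd_verts G = (if even n then verts G else {})"
    unfolding odd_verts_def using deg_complete order_ge_3 by auto
  then show ?thesis using card_verts by simp
qed

lemma connected_complete: "connected G"
proof -
  have "u \<rightarrow>\<^sup>* v" if "u \<in> verts G" "v \<in> verts G" for u v
  proof (cases "u = v")
    case False
    then have "u \<rightarrow> v" using that complete unfolding complete_digraph_def by auto
    then show ?thesis by (rule reachable_adjI)
  qed (use that in simp)
  \<comment> \<open>\<open>connected\<close> is defined through the symmetric closure, to which
    reachability carries over.\<close>
  then show ?thesis
    using verts_nonempty reachable_mk_symmetricI by (intro connectedI) auto
qed

text \<open>Both degree parameters are n - 1 and there are no leaves. For even n the fractions are
  2n/n and (4n + 2n)/(3n), where the 2n comes from the odd vertices; for odd n they are n/n and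
  3n/(3n).\<close>

lemma bounds_complete:
  "sd_bound1 G = (if even n then 2 else 1)" "sd_bound2 G = (if even n then 2 else 1)"
proof -
  have "sd_bound1 G = (if even n then 2 else 1) \<and> sd_bound2 G = (if even n then 2 else 1)"
  proof (cases "even n")
    case True
    then obtain k where "n = 2 * k" by blast
    then obtain j where n: "n = 2 * j + 2" using order_ge_3 by (cases k) auto
    show ?thesis
      unfolding sd_bound1_def sd_bound2_def Let_def floor_half_real ceiling_half_real
        floor_three_halves_real ceiling_three_halves_real max_deg_complete min_core_deg_complete
        leaves_complete card_odd_verts_complete card_verts
      by (simp add: n divide_simps)
  next
    case False
    then obtain j where n: "n = 2 * j + 1" by (elim oddE)
    show ?thesis
      unfolding sd_bound1_def sd_bound2_def Let_def floor_half_real ceiling_half_real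
        floor_three_halves_real ceiling_three_halves_real max_deg_complete min_core_deg_complete
        leaves_complete card_odd_verts_complete card_verts
      by (simp add: n divide_simps)
  qed
  then show "sd_bound1 G = (if even n then 2 else 1)" "sd_bound2 G = (if even n then 2 else 1)"
    by auto
qed

text \<open>Every closed neighbourhood is the whole vertex set, so a sign function of positive
  weight is already signed dominating.\<close>

lemma signed_dom_number_complete_le: "signed_dom_number G \<le> (if even n then 2 else 1)"
proof -
  \<comment> \<open>This is the largest number of negative vertices that keeps the weight
    positive.\<close>
  have "(n - 1) div 2 \<le> card (verts G)" unfolding card_verts by linarith
  then obtain M where M: "M \<subseteq> verts G" "card M = (n - 1) div 2"
    using obtain_subset_with_card_n by metis
  define f :: "'a \<Rightarrow> int" where "f v = 1 - 2 * of_bool (v \<in> M)" for v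
  have "(\<Sum>v\<in>verts G. f v) = int n - 2 * int (card (verts G \<inter> M))"
    unfolding f_def by (simp add: sum_subtractf sum_distrib_left[symmetric] card_verts Int_def)
  also have "\<dots> = (if even n then 2 else 1)"
  proof -
    have "int n - 2 * int ((n - 1) div 2) = (if even n then 2 else 1)"
      using order_ge_3 by simp presburger
    then show ?thesis using M by (simp add: Int_absorb1)
  qed
  finally have w: "(\<Sum>v\<in>verts G. f v) = (if even n then 2 else 1)" .
  have "signed_dominating G f"
    unfolding signed_dominating_def by (auto simp: closed_nbhd_complete w) (auto simp: f_def)
  from signed_dom_number_le[OF this] show ?thesis unfolding w .
qed

text \<open>The general lower bounds meet the weight of the explicit function.\<close>

lemma bounds_attained_complete:
  "real_of_int (signed_dom_number G) = sd_bound1 G"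
  "real_of_int (signed_dom_number G) = sd_bound2 G"
  using signed_dom_number_ge_bounds signed_dom_number_complete_le
  unfolding bounds_complete by (auto split: if_splits)

end

theorem theorem3p2:
  shows "(\<forall>G :: ('a, 'b) pre_digraph.
            graph G \<and> Digraph_Component.connected G \<and> core_verts G \<noteq> {} \<longrightarrow>
              real_of_int (signed_dom_number G) \<ge> sd_bound1 G \<and>
              real_of_int (signed_dom_number G) \<ge> sd_bound2 G) \<and>
         (\<forall>n \<ge> 3. \<forall>K :: ('c, 'd) pre_digraph. complete_digraph n K \<longrightarrow>
              Digraph_Component.connected K \<and> core_verts K \<noteq> {} \<and>
              real_of_int (signed_dom_number K) = sd_bound1 K \<and>
              real_of_int (signed_dom_number K) = sd_bound2 K)"
proof (intro conjI allI impI)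
  fix G :: "('a, 'b) pre_digraph"
  assume "graph G \<and> Digraph_Component.connected G \<and> core_verts G \<noteq> {}"
  then interpret graph G by simp
  show "real_of_int (signed_dom_number G) \<ge> sd_bound1 G"
    and "real_of_int (signed_dom_number G) \<ge> sd_bound2 G"
    by (rule signed_dom_number_ge_bounds)+
next
  fix n :: nat and K :: "('c, 'd) pre_digraph"
  assume n: "3 \<le> n" and K: "complete_digraph n K"
  from K interpret graph K unfolding complete_digraph_def by simp
  interpret complete_graph K n using n K by unfold_locales
  show "Digraph_Component.connected K" by (rule connected_complete)
  show "core_verts K \<noteq> {}" using core_verts_complete verts_nonempty by simp
  show "real_of_int (signed_dom_number K) = sd_bound1 K"
    and "real_of_int (signed_dom_number K) = sd_bound2 K"
    by (rule bounds_attained_complete)+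
qed

end
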